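(* For cluster randomized experiments, $n^{-2}y'\tilde{\mathbf d}^c y$ is an identified bound for $n^{-2}y'\mathbf d y$, where $$\tilde{\mathbf d}^c=\mathbf d+\begin{bmatrix}\mathrm I(\mathbf d_{01}=-1)&\mathrm I(\mathbf d_{01}=-1)\\ \mathrm I(\mathbf d_{01}=-1)&\mathrm I(\mathbf d_{01}=-1)\end{bmatrix}.$$ In other words, for all $y\in\mathbb R^{2n}$, $n^{-2}y'\mathbf d y\le n^{-2}y'\tilde{\mathbf d}^c y$, and $n^{-2}y'\tilde{\mathbf d}^c y$ is identified.
   Context: Cluster-randomized experiment: $n$ units are partitioned into $m$ clusters; $m_1$ clusters are chosen uniformly at random and all their units are treated; units in the remaining $m_0=m-m_1$ clusters are controls; $m_0,m_1\ge2$. $R_{1i}\in\{0,1\}$ is the treatment indicator of unit $i$, $R_{0i}=1-R_{1i}$, $\mathbf R=\mathrm{diag}(R_{01},\dots,R_{0n},R_{11},\dots,R_{1n})$, $\boldsymbol\pi=\mathrm E[\mathbf R]$. $\mathbf d=\mathrm V(1_{2n}'\boldsymbol\pi^{-1}\mathbf R)$ is the $2n\times2n$ variance-covariance matrix of the vector $1_{2n}'\boldsymbol\pi^{-1}\mathbf R$ ($1_{2n}$ the vector of ones), partitioned into $n\times n$ blocks $\mathbf d=\begin{bmatrix}\mathbf d_{00}&\mathbf d_{01}\\ \mathbf d_{10}&\mathbf d_{11}\end{bmatrix}$; e.g. $\mathbf d_{01}$ has $ij$ entry $\frac{\mathrm P(R_{0i}=1,R_{1j}=1)-\mathrm P(R_{0i}=1)\mathrm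 P(R_{1j}=1)}{\mathrm P(R_{0i}=1)\mathrm P(R_{1j}=1)}$. For a matrix $A$, $\mathrm I(A=a)$ is the 0/1 matrix of the same size indicating which entries equal $a$. For a $2n\times 2n$ matrix $\tilde{\mathbf d}$, $n^{-2}y'\tilde{\mathbf d}y$ is a bound for $n^{-2}y'\mathbf d y$ if $n^{-2}y'\mathbf d y\le n^{-2}y'\tilde{\mathbf d}y$ for all $y\in\mathbb R^{2n}$; it is an identified bound if in addition $\mathrm I(\mathbf d=-1)\circ\mathrm I(\tilde{\mathbf d}=0)=\mathrm I(\mathbf d=-1)$ with $\circ$ the elementwise product, i.e. every entry where $\mathbf d$ equals $-1$ is $0$ in $\tilde{\mathbf d}$. *)

theory Defs
  imports "HOL-Probability.Probability" "HOL-Library.Disjoint_Sets"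
begin

text \<open>
  Units are the elements of a finite type \<open>'n\<close>, so \<open>n = CARD('n)\<close>.  The \<open>2n\<close> coordinates are indexed
  by \<open>'n + 'n\<close>: \<open>Inl i\<close> is the control coordinate of unit \<open>i\<close> (position \<open>i\<close>), \<open>Inr i\<close> is its
  treatment coordinate (position \<open>n + i\<close>).
\<close>

definition diag_mat :: "real ^ 'k \<Rightarrow> real ^ 'k ^ 'k" where
  "diag_mat v = (\<chi> i j. if i = j then v $ i else 0)"

definition mat_ind :: "real ^ 'k ^ 'l \<Rightarrow> real \<Rightarrow> real ^ 'k ^ 'l" where
  "mat_ind A a = (\<chi> i j. if A $ i $ j = a then 1 else 0)"

definition elementwise_prod :: "real ^ 'k ^ 'l \<Rightarrow> real ^ 'k ^ 'l \<Rightarrow> real ^ 'k ^ 'l" (infixl "\<circ>\<^sub>e" 70) where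
  "A \<circ>\<^sub>e B = (\<chi> i j. A $ i $ j * B $ i $ j)"

definition block_mat ::
  "real ^ 'n ^ 'n \<Rightarrow> real ^ 'n ^ 'n \<Rightarrow> real ^ 'n ^ 'n \<Rightarrow> real ^ 'n ^ 'n \<Rightarrow>
   real ^ ('n::finite + 'n) ^ ('n + 'n)" where
  "block_mat A00 A01 A10 A11 = (\<chi> k l.
     case k of
       Inl i \<Rightarrow> (case l of Inl j \<Rightarrow> A00 $ i $ j | Inr j \<Rightarrow> A01 $ i $ j)
     | Inr i \<Rightarrow> (case l of Inl j \<Rightarrow> A10 $ i $ j | Inr j \<Rightarrow> A11 $ i $ j))"

definition block01 :: "real ^ ('n::finite + 'n) ^ ('n + 'n) \<Rightarrow> real ^ 'n ^ 'n" where
  "block01 A = (\<chi> i j. A $ Inl i $ Inr j)"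

text \<open>An outcome of the randomization is the set of treated clusters.\<close>

definition cluster_design :: "'n set set \<Rightarrow> nat \<Rightarrow> 'n set set pmf" where
  "cluster_design \<C> m1 = pmf_of_set {T. T \<subseteq> \<C> \<and> card T = m1}"

definition R1 :: "'n set set \<Rightarrow> 'n \<Rightarrow> real" where
  "R1 T i = (if i \<in> \<Union>T then 1 else 0)"

definition R0 :: "'n set set \<Rightarrow> 'n \<Rightarrow> real" where
  "R0 T i = 1 - R1 T i"

definition R_mat :: "'n::finite set set \<Rightarrow> real ^ ('n + 'n) ^ ('n + 'n)" where
  "R_mat T = diag_mat (\<chi> k. case k of Inl i \<Rightarrow> R0 T i | Inr i \<Rightarrow> R1 T i)"

definition covariance_matrix :: "'a pmf \<Rightarrow> ('a \<Rightarrow> real ^ 'k) \<Rightarrow> real ^ 'k ^ 'k" where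
  "covariance_matrix p X = (\<chi> k l. measure_pmf.expectation p (\<lambda>\<omega>.
     (X \<omega> $ k - measure_pmf.expectation p (\<lambda>\<omega>'. X \<omega>' $ k)) *
     (X \<omega> $ l - measure_pmf.expectation p (\<lambda>\<omega>'. X \<omega>' $ l))))"

definition pi_mat :: "'n::finite set set \<Rightarrow> nat \<Rightarrow> real ^ ('n + 'n) ^ ('n + 'n)" where
  "pi_mat \<C> m1 = measure_pmf.expectation (cluster_design \<C> m1) R_mat"

definition d_mat :: "'n::finite set set \<Rightarrow> nat \<Rightarrow> real ^ ('n + 'n) ^ ('n + 'n)" where
  "d_mat \<C> m1 = covariance_matrix (cluster_design \<C> m1)
     (\<lambda>T. vec 1 v* (matrix_inv (pi_mat \<C> m1) ** R_mat T))"

definition d_tilde_c :: "real ^ ('n::finite + 'n) ^ ('n + 'n) \<Rightarrow> real ^ ('n + 'n) ^ ('n + 'n)" where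
  "d_tilde_c d = d + (let J = mat_ind (block01 d) (- 1) in block_mat J J J J)"

definition scaled_quad_form :: "real ^ ('n::finite + 'n) ^ ('n + 'n) \<Rightarrow> real ^ ('n + 'n) \<Rightarrow> real" where
  "scaled_quad_form A y = (y \<bullet> (A *v y)) / (real CARD('n))\<^sup>2"

definition is_bound ::
  "real ^ ('n::finite + 'n) ^ ('n + 'n) \<Rightarrow> real ^ ('n + 'n) ^ ('n + 'n) \<Rightarrow> bool" where
  "is_bound d d' \<longleftrightarrow> (\<forall>y. scaled_quad_form d y \<le> scaled_quad_form d' y)"

definition is_identified_bound ::
  "real ^ ('n::finite + 'n) ^ ('n + 'n) \<Rightarrow> real ^ ('n + 'n) ^ ('n + 'n) \<Rightarrow> bool" where
  "is_identified_bound d d' \<longleftrightarrow>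
     is_bound d d' \<and> mat_ind d (- 1) \<circ>\<^sub>e mat_ind d' 0 = mat_ind d (- 1)"

end

theory Submission
  imports Defs
begin

text \<open>
  An entry of the covariance matrix \<open>d\<close> of the normalised indicators \<open>R k / E (R k)\<close> is
  \<open>E (R k * R l) / (E (R k) * E (R l)) - 1\<close>, so it equals \<open>- 1\<close> exactly when \<open>R k * R l\<close> vanishes
  almost surely.  As there are at least two treated and two control clusters, this happens only for
  a treatment and a control coordinate whose units share a cluster.  Hence \<open>I (d\<^sub>0\<^sub>1 = - 1)\<close> is the
  indicator matrix of the relation ``same cluster'', and the quadratic form of the added block
  matrix is a sum of squares, one for each cluster.
\<close>

lemma integral_measure_pmf_eq_0_iff:
  fixes f :: "'a \<Rightarrow> real"
  assumes "finite (set_pmf p)" and "\<And>x. x \<in> set_pmf p \<Longrightarrow> 0 \<le> f x"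
  shows "measure_pmf.expectation p f = 0 \<longleftrightarrow> (\<forall>x\<in>set_pmf p. f x = 0)"
  using integral_nonneg_eq_0_iff_AE[OF integrable_measure_pmf_finite[OF assms(1), of f]] assms(2)
  by (simp add: AE_measure_pmf_iff)

text \<open>Each normalised coordinate has mean 1, so the linear and constant terms of the expanded
  product contribute \<open>- 1 - 1 + 1\<close>. Finite support makes every integrand
  integrable.\<close>

lemma covariance_matrix_normalized:
  fixes f :: "'a \<Rightarrow> 'k::finite \<Rightarrow> real"
  assumes "finite (set_pmf p)"
    and "\<And>k. measure_pmf.expectation p (\<lambda>\<omega>. f \<omega> k) = e k" and "\<And>k. e k \<noteq> 0"
  shows "covariance_matrix p (\<lambda>\<omega>. \<chi> k. f \<omega> k / e k) $ k $ l =
    measure_pmf.expectation p (\<lambda>\<omega>. f \<omega> k * f \<omega> l) / (e k * e l) - 1"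
proof -
  note [simp] = integrable_measure_pmf_finite[OF assms(1)]
  have mean: "measure_pmf.expectation p (\<lambda>\<omega>. f \<omega> j / e j) = 1" for j
    using assms(2,3) by simp
  have "covariance_matrix p (\<lambda>\<omega>. \<chi> k. f \<omega> k / e k) $ k $ l =
    measure_pmf.expectation p (\<lambda>\<omega>. (f \<omega> k / e k - 1) * (f \<omega> l / e l - 1))"
    unfolding covariance_matrix_def by (simp only: vec_lambda_beta mean)
  also have "\<dots> = measure_pmf.expectation p
      (\<lambda>\<omega>. f \<omega> k * f \<omega> l / (e k * e l) - f \<omega> k / e k - f \<omega> l / e l + 1)"
    by (intro Bochner_Integration.integral_cong) (simp_all add: algebra_simps)
  also have "\<dots> = measure_pmf.expectation p (\<lambda>\<omega>. f \<omega> k * f \<omega> l / (e k * e l)) - 1"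
    by (simp add: mean del: Bochner_Integration.integral_divide_zero)
  finally show ?thesis by simp
qed

text \<open>\<open>matrix_inv\<close> is a Hilbert choice: \<open>B\<close> witnesses that the
  chosen matrix is an inverse, and multiplying by \<open>B\<close> from the left then cancels
  \<open>A\<close>.\<close>

lemma matrix_inv_eqI:
  fixes A B :: "real ^ 'k::finite ^ 'k"
  assumes "A ** B = mat 1" and "B ** A = mat 1"
  shows "matrix_inv A = B"
proof -
  have "A ** matrix_inv A = mat 1"
    unfolding matrix_inv_def by (rule someI2[of _ B]) (simp_all add: assms)
  then have "B ** (A ** matrix_inv A) = B"
    by simp
  then show ?thesis
    by (simp add: matrix_mul_assoc assms)
qed

lemma matrix_inv_diag_mat:
  fixes v :: "real ^ 'k::finite"
  assumes "\<And>k. v $ k \<noteq> 0"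
  shows "matrix_inv (diag_mat v) = diag_mat (\<chi> k. 1 / v $ k)"
proof -
  have prod: "diag_mat u ** diag_mat w = diag_mat (\<chi> k. u $ k * w $ k)" for u w :: "real ^ 'k"
    by (simp add: vec_eq_iff matrix_matrix_mult_def diag_mat_def mult_delta_left mult_delta_right)
  have one: "diag_mat (\<chi> k. 1) = (mat 1 :: real ^ 'k ^ 'k)"
    by (simp add: diag_mat_def mat_def vec_eq_iff)
  show ?thesis
    by (rule matrix_inv_eqI) (simp_all add: prod one assms)
qed

lemma vec_1_mult_diag_mat:
  fixes u w :: "real ^ 'k::finite"
  shows "vec 1 v* (diag_mat u ** diag_mat w) = (\<chi> k. u $ k * w $ k)"
  by (simp add: vec_eq_iff vector_matrix_mult_def matrix_matrix_mult_def diag_mat_def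
      mult_delta_left mult_delta_right)

text \<open>One index for all 2n indicators, so that control and treatment coordinates are handled
  uniformly.\<close>

definition R :: "'n set set \<Rightarrow> 'n + 'n \<Rightarrow> real" where
  "R T k = (case k of Inl i \<Rightarrow> R0 T i | Inr i \<Rightarrow> R1 T i)"

lemma R_simps [simp]:
  "R T (Inl i) = (if i \<in> \<Union>T then 0 else 1)" "R T (Inr i) = (if i \<in> \<Union>T then 1 else 0)"
  by (simp_all add: R_def R0_def R1_def)

lemma R_nonneg: "0 \<le> R T k"
  by (cases k) simp_all

lemma R_mat_eq: "R_mat T = diag_mat (\<chi> k. R T k)"
  by (simp add: R_mat_def R_def)

lemma pi_mat_eq:
  fixes \<C> :: "'n::finite set set"
  shows "pi_mat \<C> m1 =
    diag_mat (\<chi> k. measure_pmf.expectation (cluster_design \<C> m1) (\<lambda>T. R T k))"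
proof -
  \<comment> \<open>Polymorphic in the value type: used for the matrix-valued expectation and for
    its real entries, which reduces the claim to finite sums.\<close>
  have sum: "measure_pmf.expectation (cluster_design \<C> m1) f =
      (\<Sum>T\<in>UNIV. pmf (cluster_design \<C> m1) T *\<^sub>R f T)"
    for f :: "_ \<Rightarrow> 'b::{banach, second_countable_topology}"
    by (rule integral_measure_pmf) simp_all
  show ?thesis
    by (simp add: pi_mat_def sum R_mat_eq diag_mat_def vec_eq_iff)
qed

text \<open>Nonzero means make the diagonal matrix \<open>pi_mat\<close> invertible, so the random
  vector has the coordinates \<open>R T k\<close> divided by their means.\<close>

lemma d_mat_entry:
  fixes \<C> :: "'n::finite set set"
  assumes "\<And>k. measure_pmf.expectation (cluster_design \<C> m1) (\<lambda>T. R T k) \<noteq> 0"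
  shows "d_mat \<C> m1 $ k $ l = measure_pmf.expectation (cluster_design \<C> m1) (\<lambda>T. R T k * R T l) /
    (measure_pmf.expectation (cluster_design \<C> m1) (\<lambda>T. R T k) *
     measure_pmf.expectation (cluster_design \<C> m1) (\<lambda>T. R T l)) - 1"
proof -
  have "vec 1 v* (matrix_inv (pi_mat \<C> m1) ** R_mat T) =
      (\<chi> k. R T k / measure_pmf.expectation (cluster_design \<C> m1) (\<lambda>T. R T k))" for T
    by (simp add: pi_mat_eq R_mat_eq matrix_inv_diag_mat assms vec_1_mult_diag_mat del: vec_1)
  then show ?thesis
    by (simp add: d_mat_def covariance_matrix_normalized assms)
qed

text \<open>\<open>case_sum id id\<close> sends a coordinate to its unit. With \<open>B c\<close>
  the indicator vector of cluster \<open>c\<close>, \<open>A\<close> is the sum of the rank-one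
  matrices \<open>B c k * B c l\<close>, each of which contributes the squared total of
  \<open>y\<close> over both coordinates of the units in \<open>c\<close>.\<close>

lemma quad_form_same_part_nonneg:
  fixes y :: "real ^ ('n::finite + 'n)" and A :: "real ^ ('n + 'n) ^ ('n + 'n)"
  assumes "partition_on UNIV \<C>"
    and A: "\<And>k l. A $ k $ l = (if \<exists>c\<in>\<C>. case_sum id id k \<in> c \<and> case_sum id id l \<in> c then 1 else 0)"
  shows "0 \<le> y \<bullet> (A *v y)"
proof -
  define B where "B c k = (if case_sum id id k \<in> c then 1 else 0 :: real)" for c and k :: "'n + 'n"
  have entry: "A $ k $ l = (\<Sum>c\<in>\<C>. B c k * B c l)" for k l
  proof -
    obtain c where c: "c \<in> \<C>" "case_sum id id k \<in> c"
      using partition_onD1[OF assms(1)] by blast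
    have unique: "case_sum id id k \<in> c' \<longleftrightarrow> c' = c" if "c' \<in> \<C>" for c'
      using disjointD[OF partition_onD2[OF assms(1)]] that c by blast
    have "(\<Sum>c'\<in>\<C>. B c' k * B c' l) = (\<Sum>c'\<in>\<C>. if c' = c then B c l else 0)"
      by (intro sum.cong) (simp_all add: B_def unique)
    also have "\<dots> = B c l" using c by simp
    also have "\<dots> = A $ k $ l"
      using c(1) by (simp add: A B_def unique cong: conj_cong bex_cong)
    finally show ?thesis by simp
  qed
  have "y \<bullet> (A *v y) = (\<Sum>k\<in>UNIV. \<Sum>l\<in>UNIV. \<Sum>c\<in>\<C>. (B c k * y $ k) * (B c l * y $ l))"
    by (simp add: inner_vec_def matrix_vector_mult_def entry sum_distrib_left sum_distrib_right
        mult_ac)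
  also have "\<dots> = (\<Sum>c\<in>\<C>. \<Sum>k\<in>UNIV. \<Sum>l\<in>UNIV. (B c k * y $ k) * (B c l * y $ l))"
    \<comment> \<open>Fixing the inner index set moves the cluster sum outwards past both coordinate
      sums.\<close>
    by (simp add: sum.swap[of _ \<C>])
  also have "\<dots> = (\<Sum>c\<in>\<C>. (\<Sum>k\<in>UNIV. B c k * y $ k)\<^sup>2)"
    by (simp add: power2_eq_square sum_product)
  finally show ?thesis by (simp add: sum_nonneg)
qed

theorem theorem7p12:
  fixes \<C> :: "'n::finite set set" and m m0 m1 :: nat
  assumes "partition_on UNIV \<C>" and "card \<C> = m"
    and "m0 = m - m1" and "2 \<le> m0" and "2 \<le> m1"
  shows "is_identified_bound (d_mat \<C> m1) (d_tilde_c (d_mat \<C> m1))"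
proof -
  let ?p = "cluster_design \<C> m1"
  let ?E = "measure_pmf.expectation ?p"
  define d where "d = d_mat \<C> m1"
  define same where "same i j \<longleftrightarrow> (\<exists>c\<in>\<C>. i \<in> c \<and> j \<in> c)" for i j
  have "\<exists>c. c \<in> \<C> \<and> i \<in> c" for i
    using partition_onD1[OF assms(1)] by blast
  then obtain part where part: "\<And>i. part i \<in> \<C>" "\<And>i. i \<in> part i"
    by metis
  have part_eq: "c = part i" if "c \<in> \<C>" "i \<in> c" for c i
    using disjointD[OF partition_onD2[OF assms(1)]] that part by blast
  have same_iff: "same i j \<longleftrightarrow> part i = part j" for i j
    unfolding same_def using part part_eq by metis
  have mem_iff: "i \<in> \<Union>T \<longleftrightarrow> part i \<in> T" if "T \<subseteq> \<C>" for i T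
    using that part part_eq by blast
  \<comment> \<open>Both size conditions enter here: \<open>m1\<close> \<ge> 2 leaves room to treat
    all of \<open>A\<close>, and \<open>m0\<close> \<ge> 2 leaves at least \<open>m1\<close>
    clusters outside \<open>B\<close>.\<close>
  have treat: "\<exists>T. T \<subseteq> \<C> \<and> card T = m1 \<and> A \<subseteq> T \<and> B \<inter> T = {}"
    if AB: "A \<subseteq> \<C>" "B \<subseteq> \<C>" "A \<inter> B = {}" "card A \<le> 2" "card B \<le> 2" for A B
  proof -
    have "A \<subseteq> \<C> - B"
      using AB by blast
    moreover have "card A \<le> m1" "m1 \<le> card (\<C> - B)"
      using AB assms by (simp_all add: card_Diff_subset)
    ultimately obtain T where "A \<subseteq> T" "T \<subseteq> \<C> - B" "card T = m1"
      using exists_subset_between[of A m1 "\<C> - B"] by auto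
    then show ?thesis by blast
  qed
  \<comment> \<open>The empty instance of \<open>treat\<close> shows that there is an admissible
    treatment set, as a uniform distribution requires.\<close>
  have set_p: "set_pmf ?p = {T. T \<subseteq> \<C> \<and> card T = m1}"
    unfolding cluster_design_def using treat[of "{}" "{}"] by (intro set_pmf_of_set) auto
  have witness: "\<exists>T\<in>set_pmf ?p. R T k * R T l \<noteq> 0"
    if "\<not> (isl k \<noteq> isl l \<and> same (case_sum id id k) (case_sum id id l))" for k l
  proof -
    \<comment> \<open>\<open>K isl\<close> holds the clusters that must remain controls, and
      \<open>K\<close> of the negation those that must be treated, for both indicators to be
      1.\<close>
    define K where "K P = (\<lambda>k. part (case_sum id id k)) ` {x \<in> {k, l}. P x}" for P
    have "card (K P) \<le> card {x \<in> {k, l}. P x}" for P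
      unfolding K_def by (rule card_image_le) simp
    also have "card {x \<in> {k, l}. P x} \<le> card {k, l}" for P
      by (rule card_mono) auto
    also have "card {k, l} \<le> 2" by (simp add: card_insert_if)
    finally have card: "card (K P) \<le> 2" for P .
    have sub: "K P \<subseteq> \<C>" for P
      using part(1) by (auto simp: K_def)
    \<comment> \<open>A common cluster would come from coordinates of opposite kinds whose units
      share it, which is the excluded case.\<close>
    have disj: "K (\<lambda>x. \<not> isl x) \<inter> K isl = {}"
      using that unfolding K_def same_iff by auto
    then obtain T where T: "T \<subseteq> \<C>" "card T = m1" "K (\<lambda>x. \<not> isl x) \<subseteq> T" "K isl \<inter> T = {}"
      using treat[OF sub sub disj card card] by blast
    have "R T x \<noteq> 0" if "x \<in> {k, l}" for x
    proof -
      have "part (case_sum id id x) \<in> K P" if "P x" for P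
        using \<open>x \<in> {k, l}\<close> that unfolding K_def by blast
      from this[of isl] this[of "\<lambda>x. \<not> isl x"] show ?thesis
        using T(3,4) by (cases x) (auto simp: mem_iff[OF T(1)] simp del: Union_iff)
    qed
    then show ?thesis using T set_p by auto
  qed
  \<comment> \<open>A coordinate is never of opposite kind to itself, so its indicator is 1 for some
    outcome of positive probability.\<close>
  have ER: "?E (\<lambda>T. R T k) \<noteq> 0" for k
    using witness[of k k] by (subst integral_measure_pmf_eq_0_iff) (auto simp: R_nonneg)
  have d_iff: "d $ k $ l = - 1 \<longleftrightarrow>
      isl k \<noteq> isl l \<and> same (case_sum id id k) (case_sum id id l)" for k l
  proof -
    have "d $ k $ l = - 1 \<longleftrightarrow> ?E (\<lambda>T. R T k * R T l) = 0"
      by (simp add: d_def d_mat_entry ER)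
    also have "\<dots> \<longleftrightarrow> (\<forall>T\<in>set_pmf ?p. R T k * R T l = 0)"
      by (rule integral_measure_pmf_eq_0_iff) (auto simp: R_nonneg)
    also have "\<dots> \<longleftrightarrow> isl k \<noteq> isl l \<and> same (case_sum id id k) (case_sum id id l)"
    \<comment> \<open>Units of one cluster are treated together, so a control and a treatment
      indicator from it are never both 1. The other direction is the contrapositive of
      \<open>witness\<close>.\<close>
    proof
      assume "isl k \<noteq> isl l \<and> same (case_sum id id k) (case_sum id id l)"
      then show "\<forall>T\<in>set_pmf ?p. R T k * R T l = 0"
        by (cases k; cases l) (auto simp: set_p same_iff mem_iff simp del: Union_iff)
    qed (use witness in blast)
    finally show ?thesis .
  qed
  define A where "A = (let J = mat_ind (block01 d) (- 1) in block_mat J J J J)"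
  \<comment> \<open>All four blocks coincide, so the kinds of \<open>k\<close> and \<open>l\<close>
    no longer matter, only their units.\<close>
  have A: "A $ k $ l = (if same (case_sum id id k) (case_sum id id l) then 1 else 0)" for k l
    by (cases k; cases l) (simp_all add: A_def Let_def block_mat_def mat_ind_def block01_def d_iff)
  have tilde: "d_tilde_c d = d + A"
    by (simp add: d_tilde_c_def A_def)
  have "is_bound d (d + A)"
    unfolding is_bound_def scaled_quad_form_def
    using quad_form_same_part_nonneg[OF assms(1) A[unfolded same_def]]
    by (auto intro!: divide_right_mono simp: matrix_vector_mult_add_rdistrib inner_add_right)
  \<comment> \<open>An entry \<open>- 1\<close> of \<open>d\<close> belongs to units sharing a
    cluster, where \<open>A\<close> adds exactly 1.\<close>
  moreover have "(d + A) $ k $ l = 0" if "d $ k $ l = - 1" for k l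
    using that d_iff[of k l] by (simp add: A)
  then have "mat_ind d (- 1) \<circ>\<^sub>e mat_ind (d + A) 0 = mat_ind d (- 1)"
    by (simp add: elementwise_prod_def mat_ind_def vec_eq_iff del: vector_add_component)
  ultimately show ?thesis
    by (simp add: is_identified_bound_def flip: d_def) (simp add: tilde)
qed

end
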